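(* Let $A\in M_q(\mathbb{R})$ be a real matrix and let $\mathbb{S}=\widetilde{S}\cup\mathcal{S}^{+}_1\cup\mathcal{S}^{+}_2$. Then the sequence of matrices obtained by plugging $-k$ for $k$ in the geometric part of $A$ relative to $(\mathbb{S},\mathcal{H})$ is $\pmb{A}_d-\pi_0\pmb{0}_0$, where $\pmb{A}_d=(A_d^k)_{k\ge0}$, $A_d$ is the Drazin inverse of $A$, and $\pi_0$ is the spectral projection of $A$ at $0$.
   Context: All sequences are indexed by $k\ge0$ with componentwise operations; sequences of matrices are identified with matrices of sequences; zeroth powers are identities. $\widetilde{S}=\{\pmb{\lambda}=(\lambda^k)_{k\ge0}:\lambda\in\mathbb{R},\lambda\ne0\}$. For $r>0$ and $\vartheta\in\,]0,\pi[$ put $[r,\cos(\vartheta)]=(r^k\cos(k\vartheta))_{k\ge0}$ and $[r,\sin(\vartheta)]=(r^k\sin(k\vartheta))_{k\ge0}$; $\mathcal{S}^{+}_1=\{[r,\cos(\vartheta)]:r>0,\vartheta\in\,]0,\pi[\}$ and $\mathcal{S}^{+}_2=\{[r,\sin(\vartheta)]:r>0,\vartheta\in\,]0,\pi[\}$. $\pmb{0}_i$ is the sequence with $\pmb{0}_i(k)=\delta_{ik}$, $\mathcal{S}^{\circ}=\{\pmb{0}_i:i\ge0\}$. $\pmb{\Gamma}=(0,1,2,\dots)$, $\pmb{\Gamma}^i=(k^i)_{k\ge0}$ (with $\pmb{\Gamma}^0=(1,1,\dots)$), $\mathcal{H}=\{\pmb{\Gamma}^i:i\ge0\}$. $\mathbb{R}_{\mathcal{S}^{\circ}}$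 and $\mathbb{R}_{\mathbb{S}}$ are the real spans of $\mathcal{S}^{\circ}$ and $\mathbb{S}$. The set $\mathcal{S}^{\circ}\cup\{\pmb{s}\,\pmb{\Gamma}^i:\pmb{s}\in\mathbb{S},i\ge0\}$ is a basis of the real vector space of all real linear recurrence sequences. Hence for $A\in M_q(\mathbb{R})$ the sequence $(A^k)_{k\ge0}$ can be written uniquely (up to zero terms) as $\pmb{N}(A)+\pmb{\mathcal{B}}_0\pmb{\Gamma}^0+\cdots+\pmb{\mathcal{B}}_l\pmb{\Gamma}^l$ with $\pmb{N}(A)\in M_q(\mathbb{R}_{\mathcal{S}^{\circ}})$ and $\pmb{\mathcal{B}}_i\in M_q(\mathbb{R}_{\mathbb{S}})$; the sum $\pmb{\mathcal{B}}_0\pmb{\Gamma}^0+\cdots+\pmb{\mathcal{B}}_l\pmb{\Gamma}^l$ is the geometric part of $A$ relative to $(\mathbb{S},\mathcal{H})$. Plugging $-k$ for $k$ in it means replacing $(\lambda^k)_k$ by $(\lambda^{-k})_k$, $[r,\cos(\vartheta)]$ by $(r^{-k}\cos(-k\vartheta))_k$, $[r,\sin(\vartheta)]$ by $(r^{-k}\sin(-k\vartheta))_k$, and $(k^i)_k$ by $((-k)^i)_k$. $\pi_0$ is the projection onto the generalized eigenspace of $A$ at $0$ along the sum of the other (complex) generalized eigenspaces, i.e. onto $\ker A^q$ along $\operatorname{im}A^q$ ($\pi_0=0$ if $A$ is nonsingular). The Drazin inverse $A_d$ is the unique matrix $B$ with $A^{k}BA=A^{k}$ for some $k\ge0$, $AB=BA$,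 $BAB=B$. *)

theory Defs
  imports "HOL-Analysis.Analysis" "HOL-Library.Function_Algebras"
begin

section \<open>Real sequences\<close>

text \<open>
  The ring operations and powers of sequences are the componentwise ones of
  \<^theory>\<open>HOL-Library.Function_Algebras\<close>; that theory provides no scalar multiplication, so
  the vector space structure is obtained by interpretation.
\<close>

global_interpretation seq: vector_space "\<lambda>(c::real) (s::nat \<Rightarrow> real) k. c * s k"
  defines seq_span = seq.span
  by unfold_locales (auto simp: fun_eq_iff algebra_simps)

definition geo_seq :: "real \<Rightarrow> nat \<Rightarrow> real" where
  "geo_seq c = (\<lambda>k. c ^ k)"

definition cos_seq :: "real \<Rightarrow> real \<Rightarrow> nat \<Rightarrow> real" where
  "cos_seq r \<theta> = (\<lambda>k. r ^ k * cos (real k * \<theta>))"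

definition sin_seq :: "real \<Rightarrow> real \<Rightarrow> nat \<Rightarrow> real" where
  "sin_seq r \<theta> = (\<lambda>k. r ^ k * sin (real k * \<theta>))"

definition zero_seq :: "nat \<Rightarrow> nat \<Rightarrow> real" where
  "zero_seq i = (\<lambda>k. if k = i then 1 else 0)"

definition Gamma_seq :: "nat \<Rightarrow> real" where
  "Gamma_seq = (\<lambda>k. real k)"

definition S_tilde :: "(nat \<Rightarrow> real) set" where
  "S_tilde = {geo_seq c |c. c \<noteq> 0}"

definition S1_plus :: "(nat \<Rightarrow> real) set" where
  "S1_plus = {cos_seq r \<theta> |r \<theta>. r > 0 \<and> 0 < \<theta> \<and> \<theta> < pi}"

definition S2_plus :: "(nat \<Rightarrow> real) set" where
  "S2_plus = {sin_seq r \<theta> |r \<theta>. r > 0 \<and> 0 < \<theta> \<and> \<theta> < pi}"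

definition S_circ :: "(nat \<Rightarrow> real) set" where
  "S_circ = range zero_seq"


section \<open>Plugging $-k$ for $k$\<close>

text \<open>
  \<open>neg_base s s'\<close>: \<open>s\<close> is in the union of \<^const>\<open>S_tilde\<close>, \<^const>\<open>S1_plus\<close> and \<^const>\<open>S2_plus\<close>,
  and \<open>s'\<close> is obtained from it by plugging $-k$ for $k$.
\<close>

inductive neg_base :: "(nat \<Rightarrow> real) \<Rightarrow> (nat \<Rightarrow> real) \<Rightarrow> bool" where
  geo: "c \<noteq> 0 \<Longrightarrow> neg_base (geo_seq c) (\<lambda>k. c powi (- int k))"
| cos: "r > 0 \<Longrightarrow> 0 < \<theta> \<Longrightarrow> \<theta> < pi \<Longrightarrow>
    neg_base (cos_seq r \<theta>) (\<lambda>k. r powi (- int k) * cos (- real k * \<theta>))"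
| sin: "r > 0 \<Longrightarrow> 0 < \<theta> \<Longrightarrow> \<theta> < pi \<Longrightarrow>
    neg_base (sin_seq r \<theta>) (\<lambda>k. r powi (- int k) * sin (- real k * \<theta>))"

text \<open>
  The substitution on linear combinations of the products \<open>s * Gamma_seq ^ i\<close>: \<open>neg_graph\<close> is the
  linear relation generated by the substitutions on these products. It is the graph of a linear
  map because the products are linearly independent.
\<close>

inductive neg_graph :: "(nat \<Rightarrow> real) \<Rightarrow> (nat \<Rightarrow> real) \<Rightarrow> bool" where
  base: "neg_base s s' \<Longrightarrow> neg_graph (s * Gamma_seq ^ i) (s' * (- Gamma_seq) ^ i)"
| zero: "neg_graph 0 0"
| add: "neg_graph s s' \<Longrightarrow> neg_graph t t' \<Longrightarrow> neg_graph (s + t) (s' + t')"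
| scale: "neg_graph s s' \<Longrightarrow> neg_graph (\<lambda>k. c * s k) (\<lambda>k. c * s' k)"

definition plug_neg :: "(nat \<Rightarrow> real) \<Rightarrow> nat \<Rightarrow> real" where
  "plug_neg s = (THE s'. neg_graph s s')"


section \<open>Sequences of matrices\<close>

definition entry_seq :: "(nat \<Rightarrow> real^'q^'q) \<Rightarrow> 'q \<Rightarrow> 'q \<Rightarrow> nat \<Rightarrow> real" where
  "entry_seq M a b = (\<lambda>k. M k $ a $ b)"

definition matrices_over :: "(nat \<Rightarrow> real) set \<Rightarrow> (nat \<Rightarrow> real^'q^'q) set" where
  "matrices_over V = {M. \<forall>a b. entry_seq M a b \<in> V}"

definition plug_neg_matrix :: "(nat \<Rightarrow> real^'q^'q) \<Rightarrow> nat \<Rightarrow> real^'q^'q" where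
  "plug_neg_matrix M = (\<lambda>k. \<chi> a b. plug_neg (entry_seq M a b) k)"

text \<open>The power \<open>A ^ k\<close> of the library is the entrywise one on \<^typ>\<open>real^'q^'q\<close>.\<close>

primrec matrix_power :: "real^'q^'q \<Rightarrow> nat \<Rightarrow> real^'q^'q" where
  "matrix_power A 0 = mat 1"
| "matrix_power A (Suc k) = A ** matrix_power A k"

definition Gamma_combination :: "(nat \<Rightarrow> nat \<Rightarrow> real^'q^'q) \<Rightarrow> nat \<Rightarrow> nat \<Rightarrow> real^'q^'q" where
  "Gamma_combination B l = (\<lambda>k. \<Sum>i\<le>l. (Gamma_seq ^ i) k *\<^sub>R B i k)"

text \<open>
  The geometric part relative to \<open>S\<close> and the powers of \<^const>\<open>Gamma_seq\<close>. The decomposition is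
  unique up to zero terms when \<^const>\<open>S_circ\<close> together with the products \<open>s * Gamma_seq ^ i\<close>,
  \<open>s \<in> S\<close>, is a basis of the space of linear recurrence sequences.
\<close>

definition geometric_part :: "(nat \<Rightarrow> real) set \<Rightarrow> real^'q^'q \<Rightarrow> nat \<Rightarrow> real^'q^'q" where
  "geometric_part S A = (THE G. \<exists>N B l.
     N \<in> matrices_over (seq_span S_circ) \<and>
     (\<forall>i\<le>l. B i \<in> matrices_over (seq_span S)) \<and>
     G = Gamma_combination B l \<and>
     (\<forall>k. matrix_power A k = N k + G k))"


section \<open>Drazin inverse and spectral projection at 0\<close>

definition drazin_inverse :: "real^'q^'q \<Rightarrow> real^'q^'q" where
  "drazin_inverse A = (THE B.
     (\<exists>k. matrix_power A k ** B ** A = matrix_power A k) \<and> A ** B = B ** A \<and> B ** A ** B = B)"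

definition projection_along :: "(real^'q) set \<Rightarrow> (real^'q) set \<Rightarrow> real^'q^'q" where
  "projection_along U V = (THE P. (\<forall>x\<in>U. P *v x = x) \<and> (\<forall>x\<in>V. P *v x = 0))"

definition spectral_projection_0 :: "real^'q^'q \<Rightarrow> real^'q^'q" where
  "spectral_projection_0 A =
     projection_along {x. matrix_power A CARD('q) *v x = 0} (range (\<lambda>x. matrix_power A CARD('q) *v x))"

end

theory Submission
  imports Defs "HOL-Computational_Algebra.Fundamental_Theorem_Algebra"
begin

text \<open>
  The idea is to extend every sequence to negative indices. A linear recurrence on the integers
  can be run backwards, so a two-sided solution is determined by its values at large indices
  (\<open>shift_poly_eventually_zero\<close>). The two-sided solutions of complex recurrences are exactly the
  complex exponential polynomials, that is, the combinations of the sequences \<open>z\<^sup>n n\<^sup>i\<close> with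
  \<open>z \<noteq> 0\<close>. If \<open>s'\<close> arises from \<open>s\<close> by plugging \<open>-k\<close> for \<open>k\<close>, then \<open>s\<close> and \<open>s'\<close> are the two halves
  of one exponential polynomial (\<open>neg_graph_two_sided\<close>). Hence the substitution is well defined
  (\<open>plug_neg_eq\<close>), and it can be computed from any exponential polynomial extending \<open>s\<close>. This
  replaces the linear independence of the products of basic sequences and powers of
  \<^const>\<open>Gamma_seq\<close>.

  For the powers of \<open>A\<close> the extension is explicit. If \<open>B\<close> is the Drazin inverse, then \<open>A B\<close> is
  idempotent, \<open>A\<^sup>n (1 - A B) = 0\<close> for large \<open>n\<close>, and the sequence \<open>F\<close> with \<open>F n = A\<^sup>n A B\<close> for
  \<open>n \<ge> 0\<close> and \<open>F (-n) = B\<^sup>n\<close> for \<open>n > 0\<close> satisfies \<open>A F n = F (n + 1)\<close> for all integers \<open>n\<close>.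
  So every polynomial relation between the powers of \<open>A\<close> is a recurrence for the entries of \<open>F\<close>,
  which are therefore exponential polynomials (\<open>exp_poly_two_sided_power\<close>). Taking real parts, they
  are combinations of the prescribed basic sequences, and since \<open>F\<close> agrees eventually with the
  powers of \<open>A\<close>, its right half is the geometric part (\<open>geometric_part_eq\<close>). Plugging \<open>-k\<close> for \<open>k\<close>
  gives \<open>F (-k)\<close>, which is \<open>B\<^sup>k\<close> for \<open>k > 0\<close> and \<open>A B\<close> for \<open>k = 0\<close>; and \<open>1 - A B\<close> is
  the spectral projection at 0 (\<open>spectral_projection_0_eq\<close>).
\<close>

section \<open>Linear recurrences on the integers\<close>

text \<open>The action of a polynomial in the shift \<open>f \<mapsto> (\<lambda>n. f (n + 1))\<close> on two-sided sequences.\<close>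

definition shift_poly :: "complex poly \<Rightarrow> (int \<Rightarrow> complex) \<Rightarrow> int \<Rightarrow> complex" where
  "shift_poly p f n = (\<Sum>i\<le>degree p. coeff p i * f (n + int i))"

lemma shift_poly_bound:
  assumes "degree p \<le> d"
  shows "shift_poly p f n = (\<Sum>i\<le>d. coeff p i * f (n + int i))"
  unfolding shift_poly_def using assms
  by (intro sum.mono_neutral_left) (auto simp: coeff_eq_0)

lemma shift_poly_0 [simp]: "shift_poly 0 f n = 0"
  by (simp add: shift_poly_def)

lemma shift_poly_pCons [simp]: "shift_poly (pCons a p) f n = a * f n + shift_poly p f (n + 1)"
proof -
  have "shift_poly (pCons a p) f n =
      (\<Sum>i\<le>Suc (degree p). coeff (pCons a p) i * f (n + int i))"
    by (rule shift_poly_bound) (simp add: degree_pCons_le)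
  also have "\<dots> = a * f n + shift_poly p f (n + 1)"
    by (subst sum.atMost_Suc_shift) (simp add: shift_poly_def add_ac)
  finally show ?thesis .
qed

lemma shift_poly_add: "shift_poly (p + q) f n = shift_poly p f n + shift_poly q f n"
proof -
  define d where "d = max (degree p) (degree q)"
  have "degree (p + q) \<le> d" "degree p \<le> d" "degree q \<le> d"
    by (auto simp: d_def degree_add_le_max)
  then show ?thesis
    by (simp add: shift_poly_bound[where d = d] distrib_right sum.distrib)
qed

lemma shift_poly_smult: "shift_poly (smult c p) f n = c * shift_poly p f n"
  by (simp add: shift_poly_bound[OF degree_smult_le] shift_poly_def sum_distrib_left mult_ac)

lemma shift_poly_sum: "shift_poly (\<Sum>i\<in>I. p i) f n = (\<Sum>i\<in>I. shift_poly (p i) f n)"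
  by (induction I rule: infinite_finite_induct) (auto simp: shift_poly_add)

lemma shift_poly_monom: "shift_poly (monom c i) f n = c * f (n + int i)"
  by (induction i arbitrary: n) (auto simp: monom_Suc monom_0 add_ac)

lemma shift_poly_mult: "shift_poly (p * q) f n = shift_poly p (shift_poly q f) n"
  by (induction p arbitrary: n)
    (auto simp: mult_pCons_left shift_poly_add shift_poly_smult)

lemma shift_poly_seq_zero [simp]: "shift_poly p (\<lambda>n. 0) n = 0"
  by (simp add: shift_poly_def)

lemma shift_poly_seq_add:
  "shift_poly p (\<lambda>n. f n + g n) n = shift_poly p f n + shift_poly p g n"
  by (simp add: shift_poly_def distrib_left sum.distrib)

lemma shift_poly_seq_scale: "shift_poly p (\<lambda>n. c * f n) n = c * shift_poly p f n"
  by (simp add: shift_poly_def sum_distrib_left mult_ac)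

text \<open>A recurrence can be run backwards: its lowest nonzero coefficient determines each
  term from the later ones. So a two-sided solution is determined by any right half.\<close>

lemma shift_poly_eventually_zero:
  assumes "p \<noteq> 0" "\<And>n. shift_poly p f n = 0" "\<And>n. n \<ge> n0 \<Longrightarrow> f n = 0"
  shows "f n = 0"
  using assms(1,2)
proof (induction p arbitrary: n)
  case (pCons a p)
  show ?case
  proof (cases "a = 0")
    case True
    have "shift_poly p f m = 0" for m
      using pCons.prems(2)[of "m - 1"] True by simp
    then show ?thesis
      using pCons True by simp
  next
    case False
    have "\<forall>m\<ge>n0 - int j. f m = 0" for j
    proof (induction j)
      case 0
      then show ?case using assms(3) by simp
    next
      case (Suc j)
      have "shift_poly p f (n0 - int j) = 0"
        using Suc by (simp add: shift_poly_def)
      then have "f (n0 - int j - 1) = 0"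
        using pCons.prems(2)[of "n0 - int j - 1"] False by simp
      moreover have "m = n0 - int j - 1 \<or> m \<ge> n0 - int j" if "m \<ge> n0 - int (Suc j)" for m
        using that by linarith
      ultimately show ?case
        using Suc by blast
    qed
    from this[of "nat (n0 - n)"] show ?thesis by auto
  qed
qed auto

section \<open>Two-sided exponential polynomials\<close>

text \<open>The complex span of the two-sided sequences \<open>\<lambda>n. z\<^sup>n n\<^sup>i\<close> with \<open>z \<noteq> 0\<close>.\<close>

inductive exp_poly :: "(int \<Rightarrow> complex) \<Rightarrow> bool" where
  base: "z \<noteq> 0 \<Longrightarrow> exp_poly (\<lambda>n. z powi n * of_int n ^ i)"
| zero: "exp_poly (\<lambda>n. 0)"
| add: "exp_poly f \<Longrightarrow> exp_poly g \<Longrightarrow> exp_poly (\<lambda>n. f n + g n)"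
| scale: "exp_poly f \<Longrightarrow> exp_poly (\<lambda>n. c * f n)"

lemma exp_poly_diff: "exp_poly f \<Longrightarrow> exp_poly g \<Longrightarrow> exp_poly (\<lambda>n. f n - g n)"
  using exp_poly.add[of f "\<lambda>n. (-1) * g n"] exp_poly.scale[of g "-1"] by simp

lemma exp_poly_sum: "(\<And>i. i \<in> I \<Longrightarrow> exp_poly (f i)) \<Longrightarrow> exp_poly (\<lambda>n. \<Sum>i\<in>I. f i n)"
  by (induction I rule: infinite_finite_induct) (auto intro: exp_poly.zero exp_poly.add)

lemma of_int_plus_one_power:
  "(of_int (n + 1) :: complex) ^ i = of_int n ^ i + (\<Sum>j<i. of_nat (i choose j) * of_int n ^ j)"
proof -
  have "{..i} = insert i {..<i}" by auto
  then show ?thesis by (simp add: binomial_ring)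
qed

text \<open>The sequence satisfies some nontrivial linear recurrence. The lowest and the leading
  coefficient may sit anywhere, so only \<open>p \<noteq> 0\<close> is required.\<close>

definition shift_recurrent :: "(int \<Rightarrow> complex) \<Rightarrow> bool" where
  "shift_recurrent f \<longleftrightarrow> (\<exists>p. p \<noteq> 0 \<and> (\<forall>n. shift_poly p f n = 0))"

lemma shift_recurrent_zero: "shift_recurrent (\<lambda>n. 0)"
  unfolding shift_recurrent_def by (intro exI[of _ 1]) simp

lemma shift_recurrent_add:
  assumes "shift_recurrent f" "shift_recurrent g"
  shows "shift_recurrent (\<lambda>n. f n + g n)"
proof -
  obtain p q where p: "p \<noteq> 0" "\<And>n. shift_poly p f n = 0" and q: "q \<noteq> 0" "\<And>n. shift_poly q g n = 0"
    using assms unfolding shift_recurrent_def by blast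
  have "shift_poly p f = (\<lambda>n. 0)" "shift_poly q g = (\<lambda>n. 0)"
    using p q by auto
  then have "shift_poly (q * p) f n = 0" "shift_poly (p * q) g n = 0" for n
    by (simp_all only: shift_poly_mult shift_poly_seq_zero)
  then have "shift_poly (p * q) (\<lambda>n. f n + g n) n = 0" for n
    by (simp add: shift_poly_seq_add mult.commute[of q p])
  moreover have "p * q \<noteq> 0" using p q by simp
  ultimately show ?thesis unfolding shift_recurrent_def by blast
qed

lemma shift_recurrent_scale: "shift_recurrent f \<Longrightarrow> shift_recurrent (\<lambda>n. c * f n)"
  unfolding shift_recurrent_def by (auto simp: shift_poly_seq_scale)

lemma shift_recurrent_sum:
  "(\<And>i. i \<in> I \<Longrightarrow> shift_recurrent (f i)) \<Longrightarrow> shift_recurrent (\<lambda>n. \<Sum>i\<in>I. f i n)"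
  by (induction I rule: infinite_finite_induct)
    (auto intro: shift_recurrent_zero shift_recurrent_add)

text \<open>If \<open>q\<close> annihilates the image of \<open>f\<close> under the factor \<open>x - z\<close>, then \<open>q (x - z)\<close> annihilates
  \<open>f\<close>.\<close>

lemma shift_recurrent_step:
  assumes "shift_recurrent (\<lambda>n. f (n + 1) - z * f n)"
  shows "shift_recurrent f"
proof -
  obtain p where p: "p \<noteq> 0" "\<And>n. shift_poly p (\<lambda>n. f (n + 1) - z * f n) n = 0"
    using assms unfolding shift_recurrent_def by blast
  have "shift_poly [:-z, 1:] f = (\<lambda>n. f (n + 1) - z * f n)"
    by (auto simp: fun_eq_iff)
  then have "shift_poly (p * [:-z, 1:]) f n = 0" for n
    using p(2) by (simp only: shift_poly_mult)
  moreover have "p * [:-z, 1:] \<noteq> 0" using p(1) by (simp del: mult_pCons_right)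
  ultimately show ?thesis unfolding shift_recurrent_def by blast
qed

lemma exp_poly_imp_shift_recurrent: "exp_poly f \<Longrightarrow> shift_recurrent f"
proof (induction rule: exp_poly.induct)
  case (base z i)
  show ?case
  proof (induction i rule: less_induct)
    case (less i)
    have "z powi (n + 1) * of_int (n + 1) ^ i - z * (z powi n * of_int n ^ i) =
        (\<Sum>j<i. z * of_nat (i choose j) * (z powi n * of_int n ^ j))" for n
      unfolding of_int_plus_one_power
      using base by (simp add: power_int_add algebra_simps sum_distrib_left)
    moreover have "shift_recurrent
        (\<lambda>n. \<Sum>j<i. z * of_nat (i choose j) * (z powi n * of_int n ^ j))"
      using less by (intro shift_recurrent_sum shift_recurrent_scale) auto
    ultimately show ?case
      by (simp only: shift_recurrent_step[of "\<lambda>n. z powi n * of_int n ^ i" z])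
  qed
qed (auto intro: shift_recurrent_zero shift_recurrent_add shift_recurrent_scale)

lemma exp_poly_eventually_zero:
  assumes "exp_poly f" "\<And>n. n \<ge> n0 \<Longrightarrow> f n = 0"
  shows "f n = 0"
proof -
  obtain p where "p \<noteq> 0" "\<And>n. shift_poly p f n = 0"
    using exp_poly_imp_shift_recurrent[OF assms(1)] unfolding shift_recurrent_def by blast
  then show ?thesis using assms(2) by (rule shift_poly_eventually_zero)
qed

text \<open>The operator \<open>v \<mapsto> (\<lambda>n. v (n + 1) - z v n)\<close> maps the exponential polynomials onto
  themselves. On \<open>w\<^sup>n n\<^sup>i\<close> it keeps the degree in \<open>n\<close> if \<open>w \<noteq> z\<close> and lowers it by one if
  \<open>w = z\<close>, so a preimage is found by induction on the degree.\<close>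

lemma exp_poly_difference_equation_base:
  assumes "w \<noteq> 0"
  shows "\<exists>v. exp_poly v \<and> (\<forall>n. v (n + 1) - z * v n = w powi n * of_int n ^ i)"
proof (induction i rule: less_induct)
  case (less i)
  then have "\<forall>j. \<exists>v. j < i \<longrightarrow>
      exp_poly v \<and> (\<forall>n. v (n + 1) - z * v n = w powi n * of_int n ^ j)"
    by blast
  from choice[OF this] obtain v where v: "\<And>j. j < i \<Longrightarrow> exp_poly (v j)"
    "\<And>j n. j < i \<Longrightarrow> v j (n + 1) - z * v j n = w powi n * of_int n ^ j"
    by blast
  \<comment> \<open>It suffices to solve the equation up to terms of lower degree in \<open>n\<close>.\<close>
  have lower: ?case
    if u: "exp_poly u" and eq: "\<And>n. u (n + 1) - z * u n =
      w powi n * of_int n ^ i + (\<Sum>j<i. c j * (w powi n * of_int n ^ j))" for u c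
  proof (intro exI conjI allI)
    show "exp_poly (\<lambda>n. u n - (\<Sum>j<i. c j * v j n))"
      using v(1) u by (intro exp_poly_diff exp_poly_sum exp_poly.scale) auto
    fix n
    have "(\<Sum>j<i. c j * v j (n + 1)) - z * (\<Sum>j<i. c j * v j n) =
        (\<Sum>j<i. c j * (v j (n + 1) - z * v j n))"
      by (simp add: sum_distrib_left sum_subtractf algebra_simps)
    also have "\<dots> = (\<Sum>j<i. c j * (w powi n * of_int n ^ j))"
      using v(2) by simp
    finally show "u (n + 1) - (\<Sum>j<i. c j * v j (n + 1)) - z * (u n - (\<Sum>j<i. c j * v j n)) =
        w powi n * of_int n ^ i"
      using eq[of n] by (simp add: algebra_simps)
  qed
  show ?case
  proof (cases "w = z")
    case False
    define c where "c = 1 / (w - z)"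
    have c: "c * w - c * z = 1"
      using False by (simp add: c_def diff_divide_distrib[symmetric])
    have "c * (w powi (n + 1) * of_int (n + 1) ^ i) - z * (c * (w powi n * of_int n ^ i)) =
        (c * w - c * z) * (w powi n * of_int n ^ i) +
        (\<Sum>j<i. (c * w * of_nat (i choose j)) * (w powi n * of_int n ^ j))" for n
      unfolding of_int_plus_one_power
      using assms by (simp add: power_int_add algebra_simps sum_distrib_left)
    then show ?thesis
      unfolding c mult_1
      by (intro lower[of "\<lambda>n. c * (w powi n * of_int n ^ i)" "\<lambda>j. c * w * of_nat (i choose j)"]
          exp_poly.scale exp_poly.base assms)
  next
    case True
    define c where "c = 1 / (w * of_nat (Suc i))"
    have c: "c * w * (1 + of_nat i) = 1"
      using assms by (simp add: c_def divide_simps flip: of_nat_Suc) 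
    have "c * (w powi (n + 1) * of_int (n + 1) ^ Suc i) - z * (c * (w powi n * of_int n ^ Suc i)) =
        c * w * (1 + of_nat i) * (w powi n * of_int n ^ i) +
        (\<Sum>j<i. (c * w * of_nat (Suc i choose j)) * (w powi n * of_int n ^ j))" for n
      unfolding of_int_plus_one_power
      using assms True by (simp add: power_int_add algebra_simps sum_distrib_left
          del: binomial_Suc_Suc power_Suc)
    then show ?thesis
      unfolding c mult_1
      by (intro lower[of "\<lambda>n. c * (w powi n * of_int n ^ Suc i)" "\<lambda>j. c * w * of_nat (Suc i choose j)"]
          exp_poly.scale exp_poly.base assms)
  qed
qed

lemma exp_poly_difference_equation:
  "exp_poly g \<Longrightarrow> \<exists>v. exp_poly v \<and> (\<forall>n. v (n + 1) - z * v n = g n)"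
proof (induction rule: exp_poly.induct)
  case (base w i)
  then show ?case by (rule exp_poly_difference_equation_base)
next
  case zero
  then show ?case by (intro exI[of _ "\<lambda>n. 0"]) (simp add: exp_poly.zero)
next
  case (add f g)
  then obtain u v where "exp_poly u" "\<forall>n. u (n + 1) - z * u n = f n"
    "exp_poly v" "\<forall>n. v (n + 1) - z * v n = g n" by blast
  then show ?case
    by (intro exI[of _ "\<lambda>n. u n + v n"]) (auto simp: algebra_simps intro: exp_poly.add)
next
  case (scale f c)
  then obtain u where u: "exp_poly u" "\<And>n. u (n + 1) - z * u n = f n" by blast
  show ?case
  proof (intro exI[of _ "\<lambda>n. c * u n"] conjI allI exp_poly.scale u(1))
    show "c * u (n + 1) - z * (c * u n) = c * f n" for n
      unfolding u(2)[of n, symmetric] by (simp add: algebra_simps)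
  qed
qed

lemma geometric_two_sided:
  fixes f :: "int \<Rightarrow> complex"
  assumes "z \<noteq> 0" "\<And>n. f (n + 1) = z * f n"
  shows "f n = f 0 * z powi n"
proof (induction n rule: int_induct[of _ 0])
  case (step1 n)
  then show ?case using assms by (simp add: power_int_add)
next
  case (step2 n)
  then show ?case using assms(1) assms(2)[of "n - 1"]
    by (simp add: power_int_diff field_simps)
qed simp

lemma exp_poly_step:
  assumes "exp_poly (\<lambda>n. f (n + 1) - z * f n)"
  shows "exp_poly f"
proof -
  obtain v where v: "exp_poly v" "\<And>n. v (n + 1) - z * v n = f (n + 1) - z * f n"
    using exp_poly_difference_equation[OF assms] by metis
  define g where "g n = f n - v n" for n
  have g: "g (n + 1) = z * g n" for n
    using v(2)[of n] by (simp add: g_def algebra_simps)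
  have "exp_poly g"
  proof (cases "z = 0")
    case True
    then have "g n = 0" for n using g[of "n - 1"] by simp
    then have "g = (\<lambda>n. 0)" by auto
    then show ?thesis by (simp add: exp_poly.zero)
  next
    case False
    have "exp_poly (\<lambda>n. g 0 * (z powi n * of_int n ^ 0))"
      using False by (intro exp_poly.scale exp_poly.base)
    also have "(\<lambda>n. g 0 * (z powi n * of_int n ^ 0)) = g"
      unfolding power_0 mult_1_right by (rule ext, rule geometric_two_sided[symmetric]) (use False g in auto)
    finally show ?thesis .
  qed
  from exp_poly.add[OF this v(1)] show ?thesis by (simp add: g_def)
qed

text \<open>A two-sided solution of a recurrence is an exponential polynomial: the polynomial splits
  into linear factors, and these are removed one at a time. A factor \<open>x\<close> does no harm because
  the shift is bijective on two-sided sequences.\<close>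

lemma shift_recurrent_imp_exp_poly:
  assumes "shift_recurrent f"
  shows "exp_poly f"
proof -
  obtain p where "p \<noteq> 0" "\<And>n. shift_poly p f n = 0"
    using assms unfolding shift_recurrent_def by blast
  then show ?thesis
  proof (induction "degree p" arbitrary: p f)
    case 0
    then obtain c where "p = [:c:]" by (metis degree_eq_zeroE)
    with 0 have "f = (\<lambda>n. 0)" by auto
    then show ?case by (simp add: exp_poly.zero)
  next
    case (Suc d)
    then have "\<not> constant (poly p)" by (simp add: constant_degree)
    then obtain z where "poly p z = 0" using fundamental_theorem_of_algebra by blast
    then obtain q where q: "p = [:-z, 1:] * q" by (auto simp: poly_eq_0_iff_dvd)
    then have "q \<noteq> 0" using Suc by auto
    then have "degree q = d" using Suc(2) unfolding q by (subst (asm) degree_mult_eq) auto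
    have "shift_poly [:-z, 1:] f = (\<lambda>n. f (n + 1) - z * f n)"
      by (auto simp: fun_eq_iff)
    then have "shift_poly q (\<lambda>n. f (n + 1) - z * f n) n = 0" for n
      using Suc.prems(2)[of n] unfolding q mult.commute[of "[:-z, 1:]"] shift_poly_mult by simp
    with Suc(1) \<open>degree q = d\<close> \<open>q \<noteq> 0\<close> have "exp_poly (\<lambda>n. f (n + 1) - z * f n)"
      by blast
    then show ?case by (rule exp_poly_step)
  qed
qed

section \<open>Plugging $-k$ for $k$\<close>

lemma fun_power_apply: "(f ^ n) k = (f k :: 'a::monoid_mult) ^ n"
  by (induction n) auto

lemma rcis_power_int: "rcis r \<theta> powi n = rcis (r powi n) (of_int n * \<theta>)"
  by (simp add: rcis_def power_int_mult_distrib cis_power_int of_real_power_int)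

text \<open>A basic sequence and its substitute are the two halves of a combination of at most two
  sequences \<open>z\<^sup>n\<close>. The factor \<open>n\<^sup>i\<close> is carried along because it occurs in the
  generators of \<^const>\<open>neg_graph\<close>.\<close>

lemma neg_base_two_sided:
  assumes "neg_base s s'"
  obtains f where "\<And>i. exp_poly (\<lambda>n. f n * of_int n ^ i)"
    "\<And>k. f (int k) = s k" "\<And>k. f (- int k) = s' k"
  using assms
proof cases
  case (geo c)
  show thesis
    by (rule that[of "\<lambda>n. complex_of_real c powi n"])
      (use geo in \<open>auto simp: geo_seq_def intro: exp_poly.base\<close>)
next
  case (cos r \<theta>)
  let ?f = "\<lambda>n::int. complex_of_real (r powi n * cos (of_int n * \<theta>))"
  show thesis
  proof (rule that[of ?f])
    fix i
    have "exp_poly (\<lambda>n. (1/2) * (rcis r \<theta> powi n * of_int n ^ i) +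
        (1/2) * (rcis r (- \<theta>) powi n * of_int n ^ i))"
      using cos by (intro exp_poly.add exp_poly.scale exp_poly.base) auto
    also have "(\<lambda>n. (1/2) * (rcis r \<theta> powi n * of_int n ^ i) +
        (1/2) * (rcis r (- \<theta>) powi n * of_int n ^ i)) =
        (\<lambda>n. ((1/2) * rcis r \<theta> powi n + (1/2) * rcis r (- \<theta>) powi n) * of_int n ^ i)"
      by (simp add: algebra_simps)
    also have "(\<lambda>n. (1/2) * rcis r \<theta> powi n + (1/2) * rcis r (- \<theta>) powi n) = ?f"
      unfolding rcis_power_int
      by (auto simp: complex_eq_iff simp del: of_real_mult of_real_power_int)
    finally show "exp_poly (\<lambda>n. ?f n * of_int n ^ i)" .
  qed (use cos in \<open>auto simp: cos_seq_def\<close>)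
next
  case (sin r \<theta>)
  let ?f = "\<lambda>n::int. complex_of_real (r powi n * sin (of_int n * \<theta>))"
  show thesis
  proof (rule that[of ?f])
    fix i
    have "exp_poly (\<lambda>n. (-\<i>/2) * (rcis r \<theta> powi n * of_int n ^ i) +
        (\<i>/2) * (rcis r (- \<theta>) powi n * of_int n ^ i))"
      using sin by (intro exp_poly.add exp_poly.scale exp_poly.base) auto
    also have "(\<lambda>n. (-\<i>/2) * (rcis r \<theta> powi n * of_int n ^ i) +
        (\<i>/2) * (rcis r (- \<theta>) powi n * of_int n ^ i)) =
        (\<lambda>n. ((-\<i>/2) * rcis r \<theta> powi n + (\<i>/2) * rcis r (- \<theta>) powi n) * of_int n ^ i)"
      by (simp add: algebra_simps)
    also have "(\<lambda>n. (-\<i>/2) * rcis r \<theta> powi n + (\<i>/2) * rcis r (- \<theta>) powi n) = ?f"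
      unfolding rcis_power_int
      by (auto simp: complex_eq_iff simp del: of_real_mult of_real_power_int)
    finally show "exp_poly (\<lambda>n. ?f n * of_int n ^ i)" .
  qed (use sin in \<open>auto simp: sin_seq_def\<close>)
qed

text \<open>Sequences related by \<^const>\<open>neg_graph\<close> are the two halves of one exponential polynomial.\<close>

lemma neg_graph_two_sided:
  "neg_graph s s' \<Longrightarrow>
    \<exists>f. exp_poly f \<and> (\<forall>k. f (int k) = of_real (s k)) \<and> (\<forall>k. f (- int k) = of_real (s' k))"
proof (induction rule: neg_graph.induct)
  case (base s s' i)
  then obtain f where "\<And>i. exp_poly (\<lambda>n. f n * of_int n ^ i)"
    "\<And>k. f (int k) = s k" "\<And>k. f (- int k) = s' k"
    by (rule neg_base_two_sided) blast
  then show ?case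
    by (intro exI[of _ "\<lambda>n. f n * of_int n ^ i"]) (auto simp: Gamma_seq_def fun_power_apply)
next
  case zero
  show ?case by (intro exI[of _ "\<lambda>n. 0"]) (auto intro: exp_poly.zero)
next
  case (add s s' t t')
  then obtain f g where
    "exp_poly f" "\<forall>k. f (int k) = of_real (s k)" "\<forall>k. f (- int k) = of_real (s' k)"
    "exp_poly g" "\<forall>k. g (int k) = of_real (t k)" "\<forall>k. g (- int k) = of_real (t' k)"
    by blast
  then show ?case by (intro exI[of _ "\<lambda>n. f n + g n"]) (auto intro: exp_poly.add)
next
  case (scale s s' c)
  then obtain f where
    "exp_poly f" "\<forall>k. f (int k) = of_real (s k)" "\<forall>k. f (- int k) = of_real (s' k)"
    by blast
  then show ?case
    by (intro exI[of _ "\<lambda>n. of_real c * f n"]) (auto intro: exp_poly.scale)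
qed

lemma exp_poly_eqI:
  assumes "exp_poly f" "exp_poly g" "\<And>n. n \<ge> n0 \<Longrightarrow> f n = g n"
  shows "f = g"
  using exp_poly_eventually_zero[OF exp_poly_diff[OF assms(1,2)], of n0] assms(3) by auto

text \<open>The relation \<^const>\<open>neg_graph\<close> is functional: two-sided extensions of the same sequence
  coincide.\<close>

lemma plug_neg_eq:
  assumes "neg_graph s s'"
  shows "plug_neg s = s'"
  unfolding plug_neg_def
proof (rule the_equality)
  fix t assume "neg_graph s t"
  then obtain f g where
    f: "exp_poly f" "\<And>k. f (int k) = of_real (s k)" "\<And>k. f (- int k) = of_real (s' k)" and
    g: "exp_poly g" "\<And>k. g (int k) = of_real (s k)" "\<And>k. g (- int k) = of_real (t k)"
    using assms neg_graph_two_sided by meson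
  have "f = g"
    using f(1) g(1)
  proof (rule exp_poly_eqI[of _ _ 0])
    fix n :: int assume "n \<ge> 0"
    then show "f n = g n" using f(2)[of "nat n"] g(2)[of "nat n"] by simp
  qed
  then show "t = s'" using f(3) g(3) by auto
qed (fact assms)

text \<open>The basic sequences: geometric, cosine and sine sequences.\<close>

abbreviation S_all :: "(nat \<Rightarrow> real) set" where
  "S_all \<equiv> S_tilde \<union> S1_plus \<union> S2_plus"

lemma neg_graph_span_times_Gamma:
  assumes "b \<in> seq_span S_all"
  shows "\<exists>s'. neg_graph (\<lambda>k. (Gamma_seq ^ i) k * b k) s'"
  using assms
proof (induction rule: seq.span_induct_alt)
  case base
  show ?case using neg_graph.zero by (auto simp: zero_fun_def)
next
  case (step c x y)
  have "\<exists>x'. neg_base x x'"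
    using step(1) unfolding S_tilde_def S1_plus_def S2_plus_def by (blast intro: neg_base.intros)
  then obtain x' y' where x': "neg_base x x'" and y': "neg_graph (\<lambda>k. (Gamma_seq ^ i) k * y k) y'"
    using step by blast
  have "neg_graph ((\<lambda>k. c * (x * Gamma_seq ^ i) k) + (\<lambda>k. (Gamma_seq ^ i) k * y k))
      ((\<lambda>k. c * (x' * (- Gamma_seq) ^ i) k) + y')"
    by (intro neg_graph.add neg_graph.scale neg_graph.base x' y')
  also have "(\<lambda>k. c * (x * Gamma_seq ^ i) k) + (\<lambda>k. (Gamma_seq ^ i) k * y k) =
      (\<lambda>k. (Gamma_seq ^ i) k * ((\<lambda>k. c * x k) + y) k)"
    by (auto simp: algebra_simps)
  finally show ?case by blast
qed

lemma neg_graph_Gamma_sum: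
  assumes "\<And>i. i \<le> l \<Longrightarrow> b i \<in> seq_span S_all"
  shows "\<exists>s'. neg_graph (\<lambda>k. \<Sum>i\<le>l. (Gamma_seq ^ i) k * b i k) s'"
  using assms
proof (induction l)
  case 0
  then show ?case using neg_graph_span_times_Gamma[of "b 0" 0] by simp
next
  case (Suc l)
  then obtain s' where "neg_graph (\<lambda>k. \<Sum>i\<le>l. (Gamma_seq ^ i) k * b i k) s'" by auto
  moreover obtain t' where "neg_graph (\<lambda>k. (Gamma_seq ^ Suc l) k * b (Suc l) k) t'"
    using neg_graph_span_times_Gamma Suc.prems by blast
  ultimately have "neg_graph ((\<lambda>k. \<Sum>i\<le>l. (Gamma_seq ^ i) k * b i k) +
      (\<lambda>k. (Gamma_seq ^ Suc l) k * b (Suc l) k)) (s' + t')"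
    by (rule neg_graph.add)
  then show ?case by (auto simp: plus_fun_def)
qed

section \<open>Real parts of exponential polynomials\<close>

lemma Re_geometric_in_span_Im_pos:
  assumes "Im z > 0"
  shows "(\<lambda>k. Re (c * z ^ k)) \<in> seq_span S_all"
proof -
  define r \<theta> where "r = cmod z" and "\<theta> = Arg z"
  have \<theta>: "0 < \<theta>" "\<theta> < pi" using assms Arg_lt_pi unfolding \<theta>_def by auto
  have r: "r > 0" using assms by (auto simp: r_def)
  have z: "z = rcis r \<theta>" by (simp add: r_def \<theta>_def rcis_cmod_Arg)
  have "(\<lambda>k. Re c * cos_seq r \<theta> k) + (\<lambda>k. (- Im c) * sin_seq r \<theta> k) \<in> seq_span S_all"
    using \<theta> r by (intro seq.span_add seq.span_scale seq.span_base)
      (auto simp: S1_plus_def S2_plus_def)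
  also have "(\<lambda>k. Re c * cos_seq r \<theta> k) + (\<lambda>k. (- Im c) * sin_seq r \<theta> k) = (\<lambda>k. Re (c * z ^ k))"
    by (auto simp: z DeMoivre2 cos_seq_def sin_seq_def algebra_simps)
  finally show ?thesis .
qed

text \<open>For \<open>z\<close> in the lower half plane, conjugating \<open>c z\<^sup>k\<close> reduces to the upper half plane
  without changing the real part.\<close>

lemma Re_geometric_in_span:
  assumes "z \<noteq> 0"
  shows "(\<lambda>k. Re (c * z ^ k)) \<in> seq_span S_all"
proof -
  consider "Im z > 0" | "Im z < 0" | "Im z = 0" by linarith
  then show ?thesis
  proof cases
    case 1
    then show ?thesis by (rule Re_geometric_in_span_Im_pos)
  next
    case 2
    have "Re (c * z ^ k) = Re (cnj c * cnj z ^ k)" for k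
      by (metis complex_cnj_mult complex_cnj_power complex_cnj(1) cnj.sel(1))
    then show ?thesis using Re_geometric_in_span_Im_pos[of "cnj z" "cnj c"] 2 by simp
  next
    case 3
    then have z: "z = of_real (Re z)" by (simp add: complex_eq_iff)
    then have "Re z \<noteq> 0" using assms by auto
    then have "(\<lambda>k. Re c * geo_seq (Re z) k) \<in> seq_span S_all"
      by (intro seq.span_scale seq.span_base) (auto simp: S_tilde_def)
    also have "(\<lambda>k. Re c * geo_seq (Re z) k) = (\<lambda>k. Re (c * of_real (Re z) ^ k))"
      by (auto simp: geo_seq_def simp flip: of_real_power)
    also have "of_real (Re z) = z" using z ..
    finally show ?thesis .
  qed
qed

lemma Re_of_real_mult: "Re (of_real x * z) = x * Re z"
  by simp

text \<open>The factor \<open>c\<close> makes the induction pass through complex multiples. Every bound \<open>L \<ge> l\<close> is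
  allowed (the coefficients beyond \<open>l\<close> contribute nothing), so that finitely many sequences can
  be given a common bound.\<close>

lemma Re_exp_poly_Gamma_sum:
  assumes "exp_poly f"
  shows "\<exists>b l. (\<forall>i. b i \<in> seq_span S_all) \<and>
    (\<forall>L\<ge>l. \<forall>k. Re (c * f (int k)) = (\<Sum>i\<le>L. (Gamma_seq ^ i) k * b i k))"
  using assms
proof (induction arbitrary: c rule: exp_poly.induct)
  case (base z i)
  define b where "b j = (if j = i then (\<lambda>k. Re (c * z ^ k)) else 0)" for j
  have "Re (c * (z powi int k * of_int (int k) ^ i)) = (\<Sum>j\<le>L. (Gamma_seq ^ j) k * b j k)"
    if "L \<ge> i" for L k
  proof -
    have "(\<Sum>j\<le>L. (Gamma_seq ^ j) k * b j k) =
        (\<Sum>j\<le>L. if j = i then real k ^ i * Re (c * z ^ k) else 0)"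
      by (intro sum.cong) (auto simp: b_def Gamma_seq_def fun_power_apply)
    also have "\<dots> = real k ^ i * Re (c * z ^ k)"
      using that by simp
    also have "\<dots> = Re (of_real (real k ^ i) * (c * z ^ k))"
      using Re_of_real_mult by metis
    finally show ?thesis by (simp add: mult_ac)
  qed
  moreover have "\<forall>j. b j \<in> seq_span S_all"
    using Re_geometric_in_span[OF base] by (auto simp: b_def seq.span_zero)
  ultimately show ?case by blast
next
  case zero
  show ?case
    by (intro exI[of _ "\<lambda>i. 0"] exI[of _ 0]) (auto simp: seq.span_zero[unfolded zero_fun_def])
next
  case (add f g)
  obtain b l where b: "\<forall>i. b i \<in> seq_span S_all"
    "\<And>L k. L \<ge> l \<Longrightarrow> Re (c * f (int k)) = (\<Sum>i\<le>L. (Gamma_seq ^ i) k * b i k)"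
    using add.IH(1) by meson
  obtain d m where d: "\<forall>i. d i \<in> seq_span S_all"
    "\<And>L k. L \<ge> m \<Longrightarrow> Re (c * g (int k)) = (\<Sum>i\<le>L. (Gamma_seq ^ i) k * d i k)"
    using add.IH(2) by meson
  show ?case
  proof (intro exI[of _ "\<lambda>i. b i + d i"] exI[of _ "max l m"] conjI allI impI)
    show "b i + d i \<in> seq_span S_all" for i using b d by (intro seq.span_add) auto
    fix L k assume "L \<ge> max l m"
    then have "L \<ge> l" "L \<ge> m" by simp_all
    then have "Re (c * f (int k)) + Re (c * g (int k)) =
        (\<Sum>i\<le>L. (Gamma_seq ^ i) k * b i k) + (\<Sum>i\<le>L. (Gamma_seq ^ i) k * d i k)"
      by (simp only: b(2) d(2))
    then show "Re (c * (f (int k) + g (int k))) = (\<Sum>i\<le>L. (Gamma_seq ^ i) k * (b i + d i) k)"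
      by (simp add: algebra_simps sum.distrib)
  qed
next
  case (scale f d)
  then show ?case using scale.IH[of "c * d"] by (simp add: mult.assoc)
qed

section \<open>Matrix powers\<close>

text \<open>Stated for families, so that repetitions among the vectors are allowed.\<close>

lemma linear_relation_of_vectors:
  fixes v :: "nat \<Rightarrow> 'a::euclidean_space"
  obtains c where "(\<Sum>i\<le>DIM('a). c i *\<^sub>R v i) = 0" "\<exists>i\<le>DIM('a). c i \<noteq> 0"
proof (cases "inj_on v {..DIM('a)}")
  case True
  let ?S = "v ` {..DIM('a)}"
  have "card ?S > DIM('a)"
    using True by (simp add: card_image)
  then have "dependent ?S"
    by (intro dependent_biggerset)
  then obtain u where u: "\<exists>x\<in>?S. u x \<noteq> 0" "(\<Sum>x\<in>?S. u x *\<^sub>R x) = 0"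
    using dependent_finite[of ?S] by auto
  show thesis
    by (rule that[of "u \<circ> v"]) (use u in \<open>auto simp: sum.reindex[OF True]\<close>)
next
  case False
  then obtain i j where ij: "i \<le> DIM('a)" "j \<le> DIM('a)" "i \<noteq> j" "v i = v j"
    unfolding inj_on_def by auto
  define c where "c k = (if k = i then 1 else if k = j then -1 else 0 :: real)" for k
  have "c k *\<^sub>R v k = (if k = i then v i else 0) - (if k = j then v j else 0)" for k
    using ij by (auto simp: c_def)
  then have "(\<Sum>k\<le>DIM('a). c k *\<^sub>R v k) = 0"
    using ij by (simp add: sum_subtractf)
  then show thesis
    by (rule that) (use ij in \<open>auto simp: c_def\<close>)
qed

lemma matrix_power_add: "matrix_power A (i + j) = matrix_power A i ** matrix_power A j"
  by (induction i) (simp_all add: matrix_mul_assoc)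

lemma matrix_power_commute:
  assumes "A ** B = B ** A"
  shows "matrix_power A i ** B = B ** matrix_power A i"
proof (induction i)
  case (Suc i)
  have "matrix_power A (Suc i) ** B = A ** (B ** matrix_power A i)"
    using Suc by (simp flip: matrix_mul_assoc)
  then show ?case by (simp add: assms matrix_mul_assoc)
qed simp

lemma matrix_power_Suc_right: "matrix_power A (Suc i) = matrix_power A i ** A"
  using matrix_power_commute[of A A i] by simp

lemma matrix_add_rdistrib: "(A + B) ** (C::real^'n^'n) = A ** C + B ** C"
  by (simp add: matrix_matrix_mult_def vec_eq_iff sum.distrib distrib_right)

lemma matrix_sub_rdistrib: "(A - B) ** (C::real^'n^'n) = A ** C - B ** C"
  using matrix_add_rdistrib[of "A - B" B C] by (simp add: algebra_simps)

lemma matrix_sub_ldistrib: "(C::real^'n^'n) ** (A - B) = C ** A - C ** B"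
  using matrix_add_ldistrib[of C "A - B" B] by (simp add: algebra_simps)

lemma matrix_mul_sum_left: "(\<Sum>i\<in>I. f i) ** (B::real^'n^'n) = (\<Sum>i\<in>I. f i ** B)"
  by (induction I rule: infinite_finite_induct) (auto simp: matrix_add_rdistrib)

lemma matrix_mul_sum_right: "(B::real^'n^'n) ** (\<Sum>i\<in>I. f i) = (\<Sum>i\<in>I. B ** f i)"
  by (induction I rule: infinite_finite_induct) (auto simp: matrix_add_ldistrib)

lemma matrix_vector_mul_sum: "(B::real^'n^'n) *v (\<Sum>i\<in>I. f i) = (\<Sum>i\<in>I. B *v f i)"
  by (induction I rule: infinite_finite_induct) (auto simp: matrix_vector_right_distrib)

text \<open>Strong regularity of the matrix ring: solve a polynomial relation for its lowest term.\<close>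

lemma matrix_power_regular:
  fixes A :: "real^'q^'q"
  obtains m C where "matrix_power A m = matrix_power A (Suc m) ** C" "A ** C = C ** A"
proof -
  let ?d = "DIM(real^'q^'q)"
  obtain c where c: "(\<Sum>i\<le>?d. c i *\<^sub>R matrix_power A i) = 0" "\<exists>i\<le>?d. c i \<noteq> 0"
    using linear_relation_of_vectors[of "matrix_power A"] by blast
  obtain m where m: "c m \<noteq> 0" "\<And>i. i < m \<Longrightarrow> c i = 0"
    using c(2) exists_least_iff[of "\<lambda>i. c i \<noteq> 0"] by auto
  then have "m \<le> ?d" using c(2) by (meson le_trans linorder_not_le)
  let ?I = "{m<..?d}"
  have "{..?d} = {..<m} \<union> insert m ?I"
    using \<open>m \<le> ?d\<close> by auto
  then have "(\<Sum>i\<le>?d. c i *\<^sub>R matrix_power A i) =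
      (\<Sum>i\<in>{..<m} \<union> insert m ?I. c i *\<^sub>R matrix_power A i)" by simp
  also have "\<dots> = (\<Sum>i\<in>insert m ?I. c i *\<^sub>R matrix_power A i)"
    using m(2) by (intro sum.mono_neutral_right) auto
  finally have rel: "c m *\<^sub>R matrix_power A m = - (\<Sum>i\<in>?I. c i *\<^sub>R matrix_power A i)"
    using c(1) by (simp add: eq_neg_iff_add_eq_0)
  define d where "d i = - c i / c m" for i
  define C where "C = (\<Sum>i\<in>?I. d i *\<^sub>R matrix_power A (i - Suc m))"
  have "matrix_power A (Suc m) ** C = (\<Sum>i\<in>?I. d i *\<^sub>R matrix_power A i)"
    unfolding C_def matrix_mul_sum_right
    by (intro sum.cong) (auto simp: matrix_scalar_ac scalar_matrix_assoc[symmetric]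
        matrix_power_add[symmetric] simp del: matrix_power.simps)
  also have "\<dots> = (1 / c m) *\<^sub>R (- (\<Sum>i\<in>?I. c i *\<^sub>R matrix_power A i))"
    by (simp add: d_def scaleR_sum_right sum_negf)
  also have "\<dots> = matrix_power A m"
    unfolding rel[symmetric] using m(1) by simp
  finally have "matrix_power A m = matrix_power A (Suc m) ** C" ..
  moreover have "A ** C = C ** A"
    unfolding C_def matrix_mul_sum_right matrix_mul_sum_left
    by (intro sum.cong) (auto simp: matrix_scalar_ac scalar_matrix_assoc[symmetric]
        matrix_power_Suc_right[simplified])
  ultimately show thesis by (rule that)
qed

section \<open>The Drazin inverse\<close>

text \<open>The relation between a matrix and its Drazin inverse \<open>B\<close>.\<close>

definition is_drazin :: "real^'q^'q \<Rightarrow> real^'q^'q \<Rightarrow> bool" where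
  "is_drazin A B \<longleftrightarrow>
     (\<exists>k. matrix_power A k ** B ** A = matrix_power A k) \<and> A ** B = B ** A \<and> B ** A ** B = B"

text \<open>If \<open>A\<^sup>m = A\<^sup>m\<^sup>+\<^sup>1 C\<close> with \<open>C\<close> commuting with \<open>A\<close>, then \<open>A\<^sup>m C\<^sup>m\<^sup>+\<^sup>1\<close> is the Drazin
  inverse.\<close>

lemma is_drazin_exists:
  fixes A :: "real^'q^'q"
  shows "\<exists>B. is_drazin A B"
proof -
  obtain m C where C: "matrix_power A m = matrix_power A (Suc m) ** C" and AC: "A ** C = C ** A"
    by (rule matrix_power_regular)
  have red: "matrix_power A (m + j) ** matrix_power C j = matrix_power A m" for j
  proof (induction j)
    case (Suc j)
    have "matrix_power A (m + Suc j) ** matrix_power C (Suc j) =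
        matrix_power A j ** (matrix_power A (Suc m) ** C) ** matrix_power C j"
      using matrix_power_add[of A j "Suc m"] by (simp add: matrix_mul_assoc add_ac)
    also have "\<dots> = matrix_power A (j + m) ** matrix_power C j"
      by (simp only: C[symmetric] matrix_power_add)
    finally show ?case using Suc by (simp add: add.commute)
  qed simp
  define B where "B = matrix_power A m ** matrix_power C (Suc m)"
  have AC': "A ** matrix_power C j = matrix_power C j ** A" for j
    using matrix_power_commute[OF AC[symmetric]] by simp
  have AAC: "matrix_power A i ** matrix_power C j = matrix_power C j ** matrix_power A i" for i j
    by (rule matrix_power_commute[OF AC'])
  have AB: "A ** B = B ** A"
  proof -
    have "A ** B = (A ** matrix_power A m) ** matrix_power C (Suc m)"
      by (simp only: B_def matrix_mul_assoc)
    also have "\<dots> = matrix_power A m ** (A ** matrix_power C (Suc m))"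
      by (simp only: matrix_power_commute[of A A m, symmetric] matrix_mul_assoc)
    finally show ?thesis
      by (simp only: AC' B_def matrix_mul_assoc)
  qed
  have BA: "B ** A = matrix_power A (Suc m) ** matrix_power C (Suc m)"
    by (simp only: AB[symmetric]) (simp add: B_def matrix_mul_assoc)
  have "matrix_power A m ** B ** A = matrix_power A (m + Suc m) ** matrix_power C (Suc m)"
    by (simp only: BA matrix_power_add[of A m "Suc m"] flip: matrix_mul_assoc)
  then have 1: "matrix_power A m ** B ** A = matrix_power A m"
    by (simp only: red)
  have "B ** A ** B = A ** B ** B"
    by (simp only: AB)
  also have "\<dots> = B ** (B ** A)"
    by (simp only: AB matrix_mul_assoc[symmetric])
  also have "\<dots> = B ** (matrix_power C (Suc m) ** matrix_power A (Suc m))"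
    by (simp only: BA AAC)
  also have "\<dots> = matrix_power A m ** (matrix_power C (Suc m) ** matrix_power C (Suc m))
      ** matrix_power A (Suc m)"
    by (simp only: B_def matrix_mul_assoc)
  also have "\<dots> = matrix_power A m ** matrix_power A (Suc m) **
      (matrix_power C (Suc m) ** matrix_power C (Suc m))"
    by (simp only: matrix_power_add[symmetric] matrix_mul_assoc[symmetric] AAC)
  also have "\<dots> = (matrix_power A (m + Suc m) ** matrix_power C (Suc m)) ** matrix_power C (Suc m)"
    by (simp only: matrix_power_add[of A m] matrix_mul_assoc)
  finally have "B ** A ** B = B"
    by (simp only: red B_def)
  with 1 AB show ?thesis unfolding is_drazin_def by blast
qed

lemma is_drazin_absorb:
  assumes "is_drazin A B"
  obtains k where "\<And>n. n \<ge> k \<Longrightarrow> matrix_power A n ** B ** A = matrix_power A n"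
proof -
  obtain k where k: "matrix_power A k ** B ** A = matrix_power A k"
    using assms unfolding is_drazin_def by blast
  have "matrix_power A n ** B ** A = matrix_power A n" if "n \<ge> k" for n
  proof -
    have "matrix_power A n = matrix_power A (n - k) ** matrix_power A k"
      using that by (simp flip: matrix_power_add)
    then show ?thesis using k by (simp flip: matrix_mul_assoc)
  qed
  then show thesis by (rule that)
qed

lemma is_drazin_idempotent:
  assumes "is_drazin A B"
  shows "matrix_power A (Suc n) ** matrix_power B (Suc n) = A ** B"
proof (induction n)
  case (Suc n)
  have AB: "A ** B = B ** A" and BAB: "B ** A ** B = B"
    using assms unfolding is_drazin_def by auto
  have "matrix_power A (Suc (Suc n)) ** matrix_power B (Suc (Suc n)) =
      A ** (matrix_power A (Suc n) ** matrix_power B (Suc n)) ** B"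
    by (simp only: matrix_power.simps(2)[of A "Suc n"] matrix_power_Suc_right[of B "Suc n"]
        matrix_mul_assoc)
  also have "\<dots> = A ** (B ** A ** B)"
    by (simp only: Suc AB matrix_mul_assoc)
  finally show ?case by (simp only: BAB)
qed simp

text \<open>For two Drazin inverses \<open>B\<close> and \<open>C\<close> the product of the idempotents \<open>A C\<close> and \<open>A B\<close> equals
  both of them, since \<open>A B = A\<^sup>n B\<^sup>n\<close> and \<open>A C = C\<^sup>n A\<^sup>n\<close> for all \<open>n \<ge> 1\<close> and each idempotent acts
  as the identity on high powers of \<open>A\<close>. Hence \<open>A B = A C\<close>.\<close>

lemma is_drazin_unique:
  assumes B: "is_drazin A B" and C: "is_drazin A C"
  shows "B = C"
proof -
  have AB: "A ** B = B ** A" and BAB: "B ** A ** B = B"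
    and AC: "A ** C = C ** A" and CAC: "C ** A ** C = C"
    using assms unfolding is_drazin_def by auto
  have left: "A ** C ** (A ** B) = A ** B" if B: "is_drazin A B" and C: "is_drazin A C" for B C
  proof -
    have AC: "A ** C = C ** A" using C unfolding is_drazin_def by auto
    obtain k where k: "\<And>n. n \<ge> k \<Longrightarrow> matrix_power A n ** C ** A = matrix_power A n"
      using is_drazin_absorb[OF C] by blast
    have "(C ** A) ** matrix_power A (Suc k) = matrix_power A (Suc k) ** (C ** A)"
      by (rule matrix_power_commute[symmetric]) (simp add: AC matrix_mul_assoc)
    then have "(A ** C) ** matrix_power A (Suc k) = matrix_power A (Suc k)"
      using k[of "Suc k"] by (simp only: AC matrix_mul_assoc[symmetric])
    then show ?thesis
      unfolding is_drazin_idempotent[OF B, of k, symmetric] matrix_mul_assoc by metis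
  qed
  have right: "A ** C ** (A ** B) = A ** C"
  proof -
    obtain k where k: "\<And>n. n \<ge> k \<Longrightarrow> matrix_power A n ** B ** A = matrix_power A n"
      using is_drazin_absorb[OF B] by blast
    have CA: "A ** C = matrix_power C (Suc k) ** matrix_power A (Suc k)"
      unfolding is_drazin_idempotent[OF C, of k, symmetric]
      by (intro matrix_power_commute matrix_power_commute[symmetric] AC[symmetric])
    show ?thesis
      unfolding CA AB using k[of "Suc k"] by (simp only: matrix_mul_assoc[symmetric])
  qed
  have eq: "A ** B = A ** C"
    using left[OF B C] right by simp
  have "B = B ** (A ** C)" using BAB by (simp add: eq[symmetric] matrix_mul_assoc)
  also have "\<dots> = A ** B ** C" by (simp add: AB matrix_mul_assoc)
  also have "\<dots> = C" by (simp add: eq AC CAC)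
  finally show ?thesis .
qed

lemma is_drazin_drazin_inverse: "is_drazin A (drazin_inverse A)"
proof -
  have "\<exists>!B. is_drazin A B"
    using is_drazin_exists is_drazin_unique by blast
  from theI'[OF this] show ?thesis
    unfolding drazin_inverse_def is_drazin_def .
qed

section \<open>The spectral projection at 0\<close>

text \<open>If \<open>K\<close> is the least exponent with \<open>A\<^sup>K x = 0\<close> and \<open>K > q\<close>, then the \<open>q + 1\<close> vectors
  \<open>x, A x, \<dots>, A\<^sup>q x\<close> satisfy a nontrivial linear relation. If its lowest term has index \<open>m\<close>, then
  applying \<open>A\<^sup>K\<^sup>-\<^sup>1\<^sup>-\<^sup>m\<close> leaves a nonzero multiple of \<open>A\<^sup>K\<^sup>-\<^sup>1 x\<close>, a contradiction.\<close>

lemma matrix_power_nilpotent_vector: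
  fixes A :: "real^'q^'q"
  assumes "matrix_power A k *v x = 0"
  shows "matrix_power A CARD('q) *v x = 0"
proof -
  obtain K where K: "matrix_power A K *v x = 0" "\<And>j. j < K \<Longrightarrow> matrix_power A j *v x \<noteq> 0"
    using assms exists_least_iff[of "\<lambda>k. matrix_power A k *v x = 0"] by auto
  have later: "matrix_power A n *v x = 0" if "n \<ge> K" for n
  proof -
    have "matrix_power A n = matrix_power A (n - K) ** matrix_power A K"
      using that by (simp flip: matrix_power_add)
    then show ?thesis using K(1) by (simp flip: matrix_vector_mul_assoc)
  qed
  have "K \<le> CARD('q)"
  proof (rule ccontr)
    assume "\<not> K \<le> CARD('q)"
    then have less: "CARD('q) < K" by simp
    obtain c where c: "(\<Sum>i\<le>CARD('q). c i *\<^sub>R (matrix_power A i *v x)) = 0"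
      "\<exists>i\<le>CARD('q). c i \<noteq> 0"
      using linear_relation_of_vectors[of "\<lambda>i. matrix_power A i *v x"] by auto
    obtain m where m: "c m \<noteq> 0" "\<And>i. i < m \<Longrightarrow> c i = 0"
      using c(2) exists_least_iff[of "\<lambda>i. c i \<noteq> 0"] by auto
    then have mle: "m \<le> CARD('q)" using c(2) by (meson le_trans linorder_not_le)
    have "c i *\<^sub>R (matrix_power A (K - 1 - m + i) *v x) =
        (if i = m then c m *\<^sub>R (matrix_power A (K - 1) *v x) else 0)" for i
    proof -
      consider "i < m" | "i = m" | "i > m" by linarith
      then show ?thesis
      proof cases
        case 3
        then show ?thesis using later[of "K - 1 - m + i"] less mle by simp
      qed (use m less mle in auto)
    qed
    moreover have "matrix_power A (K - 1 - m) *v (\<Sum>i\<le>CARD('q). c i *\<^sub>R (matrix_power A i *v x)) =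
        (\<Sum>i\<le>CARD('q). c i *\<^sub>R (matrix_power A (K - 1 - m + i) *v x))"
      by (simp add: matrix_vector_mul_sum matrix_vector_mult_scaleR matrix_power_add
          matrix_vector_mul_assoc)
    ultimately have "c m *\<^sub>R (matrix_power A (K - 1) *v x) = 0"
      using c(1) mle by simp
    then show False using m(1) K(2)[of "K - 1"] less by simp
  qed
  then show ?thesis by (rule later)
qed

lemma spectral_projection_0_eq:
  fixes A :: "real^'q^'q"
  assumes "is_drazin A B"
  shows "spectral_projection_0 A = mat 1 - A ** B"
proof -
  let ?q = "CARD('q)" and ?P = "mat 1 - A ** B"
  have AB: "A ** B = B ** A"
    using assms unfolding is_drazin_def by auto
  obtain k where "matrix_power A k ** B ** A = matrix_power A k"
    using assms unfolding is_drazin_def by blast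
  then have "matrix_power A k ** ?P = 0"
    by (simp add: matrix_sub_ldistrib AB matrix_mul_assoc)
  then have k: "matrix_power A k *v (?P *v x) = 0" for x
    by (simp add: matrix_vector_mul_assoc)
  have ker: "matrix_power A ?q *v (?P *v x) = 0" for x
    by (rule matrix_power_nilpotent_vector[OF k])
  have 0: "matrix_power A ?q ** ?P = 0"
    using ker by (simp add: matrix_eq matrix_vector_mul_assoc)
  have qAB: "matrix_power A ?q ** matrix_power B ?q = A ** B"
    using is_drazin_idempotent[OF assms, of "?q - 1"] by simp
  have "matrix_power A ?q ** (A ** B) = (A ** B) ** matrix_power A ?q"
    by (rule matrix_power_commute) (simp add: AB matrix_mul_assoc)
  then have comm: "?P ** matrix_power A ?q = 0"
    using 0 by (simp add: matrix_sub_ldistrib matrix_sub_rdistrib)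
  have qBA: "matrix_power B ?q ** matrix_power A ?q = A ** B"
    unfolding qAB[symmetric]
    by (intro matrix_power_commute matrix_power_commute[symmetric] AB[symmetric])
  show "spectral_projection_0 A = ?P"
    unfolding spectral_projection_0_def projection_along_def
  proof (rule the_equality)
    show "(\<forall>x\<in>{x. matrix_power A ?q *v x = 0}. ?P *v x = x) \<and>
        (\<forall>x\<in>range (\<lambda>x. matrix_power A ?q *v x). ?P *v x = 0)"
    proof safe
      fix x assume "matrix_power A ?q *v x = 0"
      then have "(A ** B) *v x = 0"
        unfolding qBA[symmetric] by (simp flip: matrix_vector_mul_assoc)
      then show "?P *v x = x" by (simp add: matrix_vector_mult_diff_rdistrib)
    next
      fix x
      show "?P *v (matrix_power A ?q *v x) = 0"
        using comm by (simp add: matrix_vector_mul_assoc)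
    qed
    fix P' assume P': "(\<forall>x\<in>{x. matrix_power A ?q *v x = 0}. P' *v x = x) \<and>
        (\<forall>x\<in>range (\<lambda>x. matrix_power A ?q *v x). P' *v x = 0)"
    have "P' *v x = ?P *v x" for x
    proof -
      have "x = ?P *v x + matrix_power A ?q *v (matrix_power B ?q *v x)"
        by (simp add: matrix_vector_mul_assoc qAB matrix_vector_mult_diff_rdistrib)
      then have "P' *v x = P' *v (?P *v x) + P' *v (matrix_power A ?q *v (matrix_power B ?q *v x))"
        by (metis matrix_vector_right_distrib)
      then show ?thesis using P' ker by auto
    qed
    then show "P' = ?P" by (simp add: matrix_eq)
  qed
qed

section \<open>The two-sided sequence of powers\<close>

text \<open>The nonnegative powers of the invertible part \<open>A (A B)\<close> of \<open>A\<close>, continued to the negative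
  integers by the powers of its Drazin inverse \<open>B\<close>. The value at \<open>0\<close> is the idempotent \<open>A B\<close>
  and not the identity.\<close>

definition two_sided_power :: "real^'q^'q \<Rightarrow> real^'q^'q \<Rightarrow> int \<Rightarrow> real^'q^'q" where
  "two_sided_power A B n =
     (if n \<ge> 0 then matrix_power A (nat n) ** (A ** B) else matrix_power B (nat (- n)))"

lemma two_sided_power_step:
  assumes "is_drazin A B"
  shows "A ** two_sided_power A B n = two_sided_power A B (n + 1)"
proof -
  have AB: "A ** B = B ** A" and BAB: "B ** A ** B = B"
    using assms unfolding is_drazin_def by auto
  consider "n \<ge> 0" | "n = -1" | "n < -1" by linarith
  then show ?thesis
  proof cases
    case 1
    then have "nat (n + 1) = Suc (nat n)" by simp
    with 1 show ?thesis by (simp add: two_sided_power_def matrix_mul_assoc)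
  next
    case 2
    then show ?thesis by (simp add: two_sided_power_def)
  next
    case 3
    define m where "m = nat (- n) - 2"
    have m: "nat (- n) = Suc (Suc m)" "nat (- n - 1) = Suc m"
      using 3 by (auto simp: m_def)
    have "A ** (B ** (B ** matrix_power B m)) = B ** matrix_power B m"
      by (simp only: matrix_mul_assoc AB BAB)
    with 3 m show ?thesis by (simp add: two_sided_power_def)
  qed
qed

lemma two_sided_power_add:
  assumes "is_drazin A B"
  shows "matrix_power A i ** two_sided_power A B n = two_sided_power A B (n + int i)"
proof (induction i)
  case (Suc i)
  have "matrix_power A (Suc i) ** two_sided_power A B n = A ** two_sided_power A B (n + int i)"
    using Suc by (simp flip: matrix_mul_assoc)
  then show ?case by (simp add: two_sided_power_step[OF assms] add_ac)
qed simp

text \<open>Any polynomial relation between the powers of \<open>A\<close> is a recurrence for the entries.\<close>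

lemma exp_poly_two_sided_power:
  fixes A :: "real^'q^'q"
  assumes "is_drazin A B"
  shows "exp_poly (\<lambda>n. of_real (two_sided_power A B n $ a $ b))"
proof (rule shift_recurrent_imp_exp_poly)
  let ?d = "DIM(real^'q^'q)" and ?F = "two_sided_power A B"
  obtain c where c: "(\<Sum>i\<le>?d. c i *\<^sub>R matrix_power A i) = 0" "\<exists>i\<le>?d. c i \<noteq> 0"
    using linear_relation_of_vectors[of "matrix_power A"] by blast
  define p where "p = (\<Sum>i\<le>?d. monom (complex_of_real (c i)) i)"
  have "coeff p i = of_real (c i)" if "i \<le> ?d" for i
    using that by (simp add: p_def coeff_sum)
  then have "p \<noteq> 0" using c(2) by force
  moreover have "shift_poly p (\<lambda>n. of_real (?F n $ a $ b)) n = 0" for n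
  proof -
    have "(\<Sum>i\<le>?d. c i *\<^sub>R ?F (n + int i)) = (\<Sum>i\<le>?d. c i *\<^sub>R matrix_power A i) ** ?F n"
      by (simp add: matrix_mul_sum_left two_sided_power_add[OF assms]
          flip: scalar_matrix_assoc)
    then have "(\<Sum>i\<le>?d. c i *\<^sub>R ?F (n + int i)) $ a $ b = 0"
      by (simp only: c(1) times0_left zero_index)
    then have "complex_of_real (\<Sum>i\<le>?d. c i * ?F (n + int i) $ a $ b) = 0"
      by (simp add: sum_component)
    then show ?thesis by (simp add: p_def shift_poly_sum shift_poly_monom)
  qed
  ultimately show "shift_recurrent (\<lambda>n. of_real (?F n $ a $ b))"
    unfolding shift_recurrent_def by blast
qed

section \<open>The geometric part\<close>

text \<open>The span of \<^const>\<open>S_circ\<close> consists of the sequences that vanish eventually.\<close>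

lemma span_S_circ_iff: "s \<in> seq_span S_circ \<longleftrightarrow> (\<exists>K. \<forall>k\<ge>K. s k = 0)"
proof
  assume "s \<in> seq_span S_circ"
  then show "\<exists>K. \<forall>k\<ge>K. s k = 0"
  proof (induction rule: seq.span_induct_alt)
    case (step c x y)
    then obtain i K where "x = zero_seq i" "\<forall>k\<ge>K. y k = 0"
      unfolding S_circ_def by auto
    then show ?case
      by (intro exI[of _ "max K (Suc i)"]) (auto simp: zero_seq_def)
  qed auto
next
  assume "\<exists>K. \<forall>k\<ge>K. s k = 0"
  then obtain K where K: "\<And>k. k \<ge> K \<Longrightarrow> s k = 0" by blast
  have "(\<Sum>i<K. (\<lambda>k. s i * zero_seq i k)) \<in> seq_span S_circ"
    by (intro seq.span_sum seq.span_scale seq.span_base) (auto simp: S_circ_def)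
  also have "(\<Sum>i<K. (\<lambda>k. s i * zero_seq i k)) = s"
  proof
    fix k
    have "(\<Sum>i<K. (\<lambda>k. s i * zero_seq i k)) k = (\<Sum>i<K. s i * zero_seq i k)"
      by (induction K) auto
    also have "\<dots> = (\<Sum>i<K. if i = k then s k else 0)"
      by (intro sum.cong) (auto simp: zero_seq_def)
    also have "\<dots> = s k" using K[of k] by auto
    finally show "(\<Sum>i<K. (\<lambda>k. s i * zero_seq i k)) k = s k" .
  qed
  finally show "s \<in> seq_span S_circ" .
qed

lemma entry_Gamma_combination:
  "entry_seq (Gamma_combination B l) a b =
    (\<lambda>k. \<Sum>i\<le>l. (Gamma_seq ^ i) k * entry_seq (B i) a b k)"
  by (auto simp: entry_seq_def Gamma_combination_def sum_component)

text \<open>A geometric combination that agrees eventually with the powers of \<open>A\<close> is, entry by entry,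
  the right half of the two-sided sequence of powers, because it extends to an exponential
  polynomial and the entries of the two-sided sequence are exponential polynomials.\<close>

lemma neg_graph_entry_Gamma_combination:
  assumes drazin: "is_drazin A B"
    and C: "\<And>i. i \<le> l \<Longrightarrow> C i \<in> matrices_over (seq_span S_all)"
    and N: "N \<in> matrices_over (seq_span S_circ)"
    and power: "\<And>k. matrix_power A k = N k + Gamma_combination C l k"
  shows "neg_graph (entry_seq (Gamma_combination C l) a b)
      (\<lambda>k. two_sided_power A B (- int k) $ a $ b)"
    and "Gamma_combination C l k $ a $ b = two_sided_power A B (int k) $ a $ b"
proof -
  let ?g = "entry_seq (Gamma_combination C l) a b"
  have "entry_seq (C i) a b \<in> seq_span S_all" if "i \<le> l" for i
    using C[OF that] by (simp add: matrices_over_def)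
  from neg_graph_Gamma_sum[of l "\<lambda>i. entry_seq (C i) a b", OF this]
  obtain s' where s': "neg_graph ?g s'"
    unfolding entry_Gamma_combination by blast
  then obtain f where f: "exp_poly f" "\<And>k. f (int k) = of_real (?g k)"
    "\<And>k. f (- int k) = of_real (s' k)"
    using neg_graph_two_sided by blast
  obtain K where K: "\<And>k. k \<ge> K \<Longrightarrow> N k $ a $ b = 0"
    using N span_S_circ_iff[of "entry_seq N a b"] by (auto simp: matrices_over_def entry_seq_def)
  obtain m where m: "\<And>n. n \<ge> m \<Longrightarrow> matrix_power A n ** B ** A = matrix_power A n"
    using is_drazin_absorb[OF drazin] by blast
  have AB: "A ** B = B ** A" using drazin by (simp add: is_drazin_def)
  have eq: "f = (\<lambda>n. of_real (two_sided_power A B n $ a $ b))"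
    using f(1) exp_poly_two_sided_power[OF drazin]
  proof (rule exp_poly_eqI[of _ _ "int (max K m)"])
    fix n assume n: "n \<ge> int (max K m)"
    define k where "k = nat n"
    have k: "n = int k" "k \<ge> K" "k \<ge> m" using n by (auto simp: k_def)
    have "two_sided_power A B n = matrix_power A k"
      using m[OF k(3)] by (simp add: two_sided_power_def k(1) AB matrix_mul_assoc)
    moreover have "matrix_power A k $ a $ b = ?g k"
      using K[OF k(2)] by (simp add: power entry_seq_def)
    ultimately show "f n = of_real (two_sided_power A B n $ a $ b)"
      using f(2)[of k] k(1) by simp
  qed
  then have "s' = (\<lambda>k. two_sided_power A B (- int k) $ a $ b)"
    using f(3) by (auto simp: fun_eq_iff)
  with s' show "neg_graph ?g (\<lambda>k. two_sided_power A B (- int k) $ a $ b)"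
    by simp
  show "Gamma_combination C l k $ a $ b = two_sided_power A B (int k) $ a $ b"
    using f(2)[of k] eq by (simp add: entry_seq_def)
qed

lemma geometric_decomposition_exists:
  fixes A :: "real^'q^'q"
  assumes "is_drazin A B"
  obtains N C l where "N \<in> matrices_over (seq_span S_circ)"
    "\<And>i. C i \<in> matrices_over (seq_span S_all)"
    "\<And>k. matrix_power A k = N k + Gamma_combination C l k"
proof -
  let ?F = "two_sided_power A B"
  define good where "good b l f \<longleftrightarrow> (\<forall>i. b i \<in> seq_span S_all) \<and>
    (\<forall>L\<ge>l. \<forall>k. f (int k) = (\<Sum>i\<le>L. (Gamma_seq ^ i) k * b i k))"
    for b and l :: nat and f :: "int \<Rightarrow> real"
  have "\<exists>c l. good c l (\<lambda>n. ?F n $ a $ b)" for a b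
    using Re_exp_poly_Gamma_sum[OF exp_poly_two_sided_power[OF assms, of a b], of 1]
    by (simp add: good_def)
  then obtain c l where good: "\<And>a b. good (c a b) (l a b) (\<lambda>n. ?F n $ a $ b)"
    by metis
  \<comment> \<open>A common bound for the exponents occurring in all entries.\<close>
  define L where "L = (\<Sum>a\<in>UNIV. \<Sum>b\<in>UNIV. l a b)"
  have L: "l a b \<le> L" for a b
  proof -
    have "l a b \<le> (\<Sum>b\<in>UNIV. l a b)" by (rule member_le_sum) auto
    also have "\<dots> \<le> L" unfolding L_def
      by (rule member_le_sum[of a UNIV "\<lambda>a. \<Sum>b\<in>UNIV. l a b"]) auto
    finally show ?thesis .
  qed
  define C where "C i k = (\<chi> a b. c a b i k)" for i k
  have G: "Gamma_combination C L k = ?F (int k)" for k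
  proof -
    have "?F (int k) $ a $ b = (\<Sum>i\<le>L. (Gamma_seq ^ i) k * c a b i k)" for a b
      using good[of a b] L[of a b] by (auto simp: good_def)
    then show ?thesis
      by (simp add: vec_eq_iff Gamma_combination_def C_def sum_component)
  qed
  have AB: "A ** B = B ** A" using assms by (simp add: is_drazin_def)
  obtain m where m: "\<And>n. n \<ge> m \<Longrightarrow> matrix_power A n ** B ** A = matrix_power A n"
    using is_drazin_absorb[OF assms] by blast
  show thesis
  proof (rule that[of "\<lambda>k. matrix_power A k - ?F (int k)" C L])
    have "matrix_power A k - ?F (int k) = 0" if "k \<ge> m" for k
      using m[OF that] by (simp add: two_sided_power_def AB matrix_mul_assoc)
    then show "(\<lambda>k. matrix_power A k - ?F (int k)) \<in> matrices_over (seq_span S_circ)"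
      unfolding matrices_over_def mem_Collect_eq span_S_circ_iff entry_seq_def
      by (intro allI exI[of _ m] impI) (simp only: zero_index)
    show "C i \<in> matrices_over (seq_span S_all)" for i
      using good by (simp add: matrices_over_def entry_seq_def C_def good_def)
    show "matrix_power A k = matrix_power A k - ?F (int k) + Gamma_combination C L k" for k
      by (simp add: G)
  qed
qed

lemma geometric_part_eq:
  fixes A :: "real^'q^'q"
  assumes drazin: "is_drazin A B"
  shows "geometric_part S_all A = (\<lambda>k. two_sided_power A B (int k))"
    and "neg_graph (entry_seq (geometric_part S_all A) a b)
      (\<lambda>k. two_sided_power A B (- int k) $ a $ b)"
proof -
  obtain N C l where NCl: "N \<in> matrices_over (seq_span S_circ)"
    "\<And>i. C i \<in> matrices_over (seq_span S_all)"
    "\<And>k. matrix_power A k = N k + Gamma_combination C l k"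
    using geometric_decomposition_exists[OF drazin] by blast
  have G: "Gamma_combination D m = (\<lambda>k. two_sided_power A B (int k))"
    if "M \<in> matrices_over (seq_span S_circ)"
      "\<forall>i\<le>m. D i \<in> matrices_over (seq_span S_all)"
      "\<forall>k. matrix_power A k = M k + Gamma_combination D m k" for M D m
    using neg_graph_entry_Gamma_combination(2)[OF drazin, of m D M] that
    by (simp add: fun_eq_iff vec_eq_iff)
  show eq: "geometric_part S_all A = (\<lambda>k. two_sided_power A B (int k))"
    unfolding geometric_part_def
  proof (rule the_equality)
    show "\<exists>N C l. N \<in> matrices_over (seq_span S_circ) \<and>
        (\<forall>i\<le>l. C i \<in> matrices_over (seq_span S_all)) \<and>
        (\<lambda>k. two_sided_power A B (int k)) = Gamma_combination C l \<and>
        (\<forall>k. matrix_power A k = N k + two_sided_power A B (int k))"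
      using NCl G[of N l C] by (intro exI[of _ N] exI[of _ C] exI[of _ l]) (auto simp: fun_eq_iff)
  qed (use G in blast)
  have "Gamma_combination C l = geometric_part S_all A"
    unfolding eq using NCl by (intro G) auto
  then show "neg_graph (entry_seq (geometric_part S_all A) a b)
      (\<lambda>k. two_sided_power A B (- int k) $ a $ b)"
    using neg_graph_entry_Gamma_combination(1)[OF drazin NCl(2,1,3)] by simp
qed

theorem theorem4p6:
  fixes A :: "real^'q^'q"
  shows "plug_neg_matrix (geometric_part (S_tilde \<union> S1_plus \<union> S2_plus) A) =
    (\<lambda>k. matrix_power (drazin_inverse A) k - zero_seq 0 k *\<^sub>R spectral_projection_0 A)"
proof
  fix k
  let ?B = "drazin_inverse A"
  have drazin: "is_drazin A ?B" by (rule is_drazin_drazin_inverse)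
  have "plug_neg_matrix (geometric_part S_all A) k = two_sided_power A ?B (- int k)"
    by (simp add: plug_neg_matrix_def vec_eq_iff plug_neg_eq[OF geometric_part_eq(2)[OF drazin]])
  also have "\<dots> = matrix_power ?B k - zero_seq 0 k *\<^sub>R spectral_projection_0 A"
    by (cases "k = 0")
      (auto simp: two_sided_power_def zero_seq_def spectral_projection_0_eq[OF drazin])
  finally show "plug_neg_matrix (geometric_part S_all A) k =
      matrix_power ?B k - zero_seq 0 k *\<^sub>R spectral_projection_0 A" .
qed

end
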